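(* Let $q,y$ be complex numbers with $0<|q|<1$ and $|y|<1$. (a) For every complex number $z$, $$\sum_{n=0}^\infty y^n\,(-zq^{n+1};q)_n\,(-zq^{2n+2};q^2)_\infty=\sum_{n=0}^{\infty}z^nq^{n^2+n}\frac{(-y;q)_n}{(yq^n;q)_{n+1}}\sum_{k=0}^{n} q^{2k}\frac{(y/q;q)_{2k}}{(q^2;q^2)_k\,(y^2;q^2)_k}.$$ (b) For every complex number $z$ with $|zq|<1$, $$\sum_{n=1}^\infty\frac{y^{n-1}}{(zq^n;q)_{n+1}\,(zq^{2n+2};q^2)_\infty}=\sum_{n=0}^\infty (qz)^n\frac{(-y;q)_n}{(yq^n;q)_{n+1}}\sum_{k=0}^{n} q^k\frac{(y/q;q)_{2k}}{(q^2;q^2)_k\,(y^2;q^2)_k}.$$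
   Context: For $|p|<1$: $(x;p)_\infty=\prod_{i=0}^\infty(1-xp^i)$ and, for integers $n\ge 0$, $(x;p)_n=\prod_{i=0}^{n-1}(1-xp^i)$ (empty product equal to $1$). The convention $0^0=1$ is used. *)

theory Defs
  imports "HOL-Analysis.Analysis"
begin

definition qpoch :: "complex \<Rightarrow> complex \<Rightarrow> nat \<Rightarrow> complex" where
  "qpoch x p n = (\<Prod>i<n. 1 - x * p ^ i)"

(* prodinf follows has_prod, so the value is 0 (not undefined) when finitely many factors vanish. *)
definition qpoch_inf :: "complex \<Rightarrow> complex \<Rightarrow> complex" where
  "qpoch_inf x p = (\<Prod>i. 1 - x * p ^ i)"

lemma convergent_prod_qpoch_inf:
  fixes x p :: complex
  assumes "norm p < 1"
  shows "convergent_prod (\<lambda>i. 1 - x * p ^ i)"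
proof -
  have "summable (\<lambda>i. norm (1 - x * p ^ i - 1))"
    using assms by (simp add: norm_mult norm_power summable_geometric summable_mult)
  then show ?thesis
    by (intro abs_convergent_prod_imp_convergent_prod summable_imp_abs_convergent_prod)
qed

end

(* Each side of (a), as a function G(z,y), satisfies
     G(z,y) = (-zq^2;q^2)_oo + y G(zq^2,y) + zq^2 y G(zq^2,yq),
   and each side of (b) satisfies
     G(z,y) = 1/(zq^2;q^2)_oo + zq G(z,yq) + y G(zq^2,y).
   On the left this is a relation between consecutive summands; on the right it is a recurrence
   for the coefficients of z^n, which follows from a telescoping finite identity and Euler's
   expansions of the infinite products. The difference D of the two sides is bounded and satisfies
   the homogeneous equation, which contracts a suitable weighted sup norm, so D = 0. *)

theory Submission
  imports Defs
begin

text \<open>The functional equations shift z to z q^2 and y to y q, so the comparison needs a set of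
  pairs (z,y) stable under both shifts, with bounds uniform over that set. Hence the products are
  estimated explicitly and not only shown to converge.

  In the plain sup norm the homogeneous equations need not contract: the factor is |y| (1 + |z q^2|)
  in (a), unbounded in z, and |z q| + |y| in (b), which may be close to 2. The shifted points have
  smaller modulus, though, so a weight growing exponentially in |z|, respectively in |z q| + |y|,
  brings the factor below 1.

  On the right, passing from G(z,y) to G(z,y) - y G(z q^2,y) multiplies the coefficient of z^n by 1
  - y q^(2n). This is exactly the last factor of (y q^n;q)_(n+1); without it, the denominator is the
  one belonging to the pair (yq, n-1). It remains to compare the inner sum for y with the shorter
  one for yq, and up to simple factors these differ by a single closed product.\<close>

section \<open>Finite and infinite q-Pochhammer products and uniform bounds for them\<close>

lemma qpoch_0 [simp]: "qpoch x p 0 = 1"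
  by (simp add: qpoch_def)

lemma qpoch_Suc: "qpoch x p (Suc n) = qpoch x p n * (1 - x * p ^ n)"
  by (simp add: qpoch_def)

lemma qpoch_add: "qpoch x p (m + n) = qpoch x p m * qpoch (x * p ^ m) p n"
  by (induction n) (simp_all add: qpoch_Suc power_add mult.assoc)

lemma qpoch_Suc_shift: "qpoch x p (Suc n) = (1 - x) * qpoch (x * p) p n"
  using qpoch_add[of x p 1 n] by (simp add: qpoch_Suc)

lemma qpoch_square: "qpoch (x ^ 2) (p ^ 2) n = qpoch x p n * qpoch (- x) p n"
  by (induction n) (simp_all add: qpoch_Suc algebra_simps power2_eq_square power_mult_distrib)

lemma qpoch_nonzero:
  assumes "norm x < 1" "norm p \<le> 1"
  shows "qpoch x p n \<noteq> 0"
proof -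
  have "x * p ^ i \<noteq> 1" for i
  proof
    assume "x * p ^ i = 1"
    then have "norm x * norm p ^ i = 1"
      by (metis norm_mult norm_one norm_power)
    moreover have "norm x * norm p ^ i \<le> norm x"
      using assms by (simp add: mult_left_le power_le_one)
    ultimately show False using assms by simp
  qed
  then show ?thesis by (auto simp: qpoch_def dest: sym)
qed

lemma sum_power_le:
  fixes t :: real
  assumes "0 \<le> t" "t < 1"
  shows "(\<Sum>i<n. t ^ i) \<le> 1 / (1 - t)"
  using sum_le_suminf[of "\<lambda>i. t ^ i" "{..<n}"] assms
  by (simp add: summable_geometric suminf_geometric)

text \<open>Each factor is at most the exponential of |x| |p|^i, and these exponents have a
  convergent geometric sum. The bound is free of \<open>n\<close>, so it passes to the infinite
  product.\<close>

lemma norm_qpoch_le: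
  assumes "norm p < 1"
  shows "norm (qpoch x p n) \<le> exp (norm x / (1 - norm p))"
proof -
  have "norm (qpoch x p n) = (\<Prod>i<n. norm (1 - x * p ^ i))"
    by (simp add: qpoch_def prod_norm)
  also have "\<dots> \<le> (\<Prod>i<n. exp (norm x * norm p ^ i))"
  proof (intro prod_mono conjI)
    fix i
    have "norm (1 - x * p ^ i) \<le> 1 + norm x * norm p ^ i"
      using norm_triangle_ineq4[of 1 "x * p ^ i"] by (simp add: norm_mult norm_power)
    also have "\<dots> \<le> exp (norm x * norm p ^ i)"
      by (rule exp_ge_add_one_self)
    finally show "norm (1 - x * p ^ i) \<le> exp (norm x * norm p ^ i)" .
  qed simp
  also have "\<dots> = exp (norm x * (\<Sum>i<n. norm p ^ i))"
    by (simp add: exp_sum sum_distrib_left)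
  also have "\<dots> \<le> exp (norm x / (1 - norm p))"
    using mult_left_mono[OF sum_power_le[of "norm p" n], of "norm x"] assms by simp
  finally show ?thesis .
qed

text \<open>With t = r |p|^i, the chain 1/(1-t) \<le> exp(t/(1-t)) \<le> exp(t/(1-r)) bounds each
  factor from below. The result depends on \<open>x\<close> only through \<open>r\<close>, so
  denominators stay away from zero uniformly on a disc and in \<open>n\<close>.\<close>

lemma norm_qpoch_ge:
  assumes "norm x \<le> r" "r < 1" "norm p < 1"
  shows "exp (- (r / (1 - r) / (1 - norm p))) \<le> norm (qpoch x p n)"
proof -
  have r0: "0 \<le> r" using assms(1) norm_ge_zero order_trans by blast
  have "exp (- (r / (1 - r) / (1 - norm p))) \<le> exp (- (r / (1 - r) * (\<Sum>i<n. norm p ^ i)))"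
    using mult_left_mono[OF sum_power_le[of "norm p" n], of "r / (1 - r)"] assms r0 by simp
  also have "\<dots> = (\<Prod>i<n. exp (- (r / (1 - r) * norm p ^ i)))"
    by (simp add: exp_sum sum_distrib_left flip: sum_negf)
  also have "\<dots> \<le> (\<Prod>i<n. norm (1 - x * p ^ i))"
  proof (intro prod_mono conjI)
    fix i
    define t where "t = r * norm p ^ i"
    have t: "0 \<le> t" "t \<le> r"
      using r0 assms by (simp_all add: t_def mult_left_le power_le_one)
    have "1 / (1 - t) = 1 + t / (1 - t)"
      using t assms by (simp add: field_simps)
    also have "\<dots> \<le> exp (t / (1 - t))"
      by (rule exp_ge_add_one_self)
    also have "\<dots> \<le> exp (t / (1 - r))"
      using t assms by (simp add: frac_le)
    finally have "exp (- (t / (1 - r))) \<le> 1 - t"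
      using t assms by (simp add: exp_minus field_simps)
    also have "\<dots> \<le> 1 - norm (x * p ^ i)"
      using assms by (simp add: t_def norm_mult norm_power mult_right_mono)
    also have "\<dots> \<le> norm (1 - x * p ^ i)"
      using norm_triangle_ineq2[of 1 "x * p ^ i"] by simp
    finally show "exp (- (r / (1 - r) * norm p ^ i)) \<le> norm (1 - x * p ^ i)"
      by (simp add: t_def)
  qed simp
  also have "\<dots> = norm (qpoch x p n)"
    by (simp add: qpoch_def prod_norm)
  finally show ?thesis .
qed

lemma qpoch_LIMSEQ:
  assumes "norm p < 1"
  shows "(\<lambda>n. qpoch x p n) \<longlonglongrightarrow> qpoch_inf x p"
proof -
  have "(\<lambda>n. qpoch x p (Suc n)) \<longlonglongrightarrow> qpoch_inf x p"
    using convergent_prod_LIMSEQ[OF convergent_prod_qpoch_inf[OF assms, of x]]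
    by (simp add: qpoch_def qpoch_inf_def lessThan_Suc_atMost)
  then show ?thesis by (simp add: filterlim_sequentially_Suc)
qed

lemma qpoch_inf_shift:
  assumes "norm p < 1"
  shows "qpoch_inf x p = (1 - x) * qpoch_inf (x * p) p"
proof (rule LIMSEQ_unique)
  show "(\<lambda>n. qpoch x p (Suc n)) \<longlonglongrightarrow> qpoch_inf x p"
    using qpoch_LIMSEQ[OF assms] by (simp add: filterlim_sequentially_Suc)
  show "(\<lambda>n. qpoch x p (Suc n)) \<longlonglongrightarrow> (1 - x) * qpoch_inf (x * p) p"
    unfolding qpoch_Suc_shift by (intro tendsto_intros qpoch_LIMSEQ assms)
qed

lemma norm_qpoch_inf_le:
  assumes "norm p < 1"
  shows "norm (qpoch_inf x p) \<le> exp (norm x / (1 - norm p))"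
  using LIMSEQ_le_const2[OF tendsto_norm[OF qpoch_LIMSEQ[OF assms]]] norm_qpoch_le[OF assms]
  by blast

lemma norm_qpoch_inf_ge:
  assumes "norm x \<le> r" "r < 1" "norm p < 1"
  shows "exp (- (r / (1 - r) / (1 - norm p))) \<le> norm (qpoch_inf x p)"
  using LIMSEQ_le_const[OF tendsto_norm[OF qpoch_LIMSEQ[OF assms(3)]]] norm_qpoch_ge[OF assms]
  by blast

section \<open>Series: a summability criterion and Euler's expansion of a reciprocal product\<close>

text \<open>The term is the n-th power of t^(n+1) r, which is eventually below 1/2. This gives
  convergence for every z in part (a).\<close>

lemma summable_power_square:
  fixes t r :: real
  assumes "0 \<le> t" "t < 1" "0 \<le> r"
  shows "summable (\<lambda>n. t ^ (n ^ 2 + n) * r ^ n)"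
proof -
  have "(\<lambda>n. t ^ n * r) \<longlonglongrightarrow> 0 * r"
    using assms by (intro tendsto_intros LIMSEQ_power_zero) auto
  then have "eventually (\<lambda>n. t ^ n * r < 1 / 2) sequentially"
    by (rule order_tendstoD) simp
  then obtain N where N: "\<And>n. n \<ge> N \<Longrightarrow> t ^ n * r < 1 / 2"
    by (auto simp: eventually_sequentially)
  show ?thesis
  proof (rule summable_comparison_test')
    show "summable (\<lambda>n. (1 / 2 :: real) ^ n)" by (simp add: summable_geometric)
    fix n assume "n \<ge> N"
    have "t ^ (n ^ 2 + n) * r ^ n = (t ^ Suc n * r) ^ n"
      by (simp add: power_mult_distrib power2_eq_square flip: power_mult) (simp add: power_add power_mult)
    also have "\<dots> \<le> (1 / 2) ^ n"
      using N[of "Suc n"] \<open>n \<ge> N\<close> assms by (intro power_mono) auto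
    finally show "norm (t ^ (n ^ 2 + n) * r ^ n) \<le> (1 / 2) ^ n"
      using assms by simp
  qed
qed

text \<open>The power series E satisfies (1 - z) E(z) = E(zp). Iteration drives the argument to 0,
  where E is continuous with value 1, so E(x) times the infinite product is 1; in particular that
  product is nonzero.\<close>

lemma euler_sum:
  assumes x: "norm x < 1" and p: "norm p < 1"
  shows "(\<lambda>n. x ^ n / qpoch p p n) sums (1 / qpoch_inf x p)"
proof -
  define a where "a n = 1 / qpoch p p n" for n
  define E where "E z = (\<Sum>n. a n * z ^ n)" for z
  define cB where "cB = exp (- (norm p / (1 - norm p) / (1 - norm p)))"
  have B: "cB \<le> norm (qpoch p p k)" for k
    unfolding cB_def by (rule norm_qpoch_ge) (use p in auto)
  have cB: "0 < cB" by (simp add: cB_def)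
  have sm: "summable (\<lambda>n. a n * z ^ n)" if "norm z < 1" for z
  proof (rule summable_comparison_test')
    show "summable (\<lambda>n. 1 / cB * norm z ^ n)"
      using that by (intro summable_mult summable_geometric) auto
    fix n
    show "norm (a n * z ^ n) \<le> 1 / cB * norm z ^ n"
      using frac_le[OF _ order_refl cB B, of "norm z ^ n" n]
      by (simp add: a_def norm_mult norm_divide norm_power)
  qed
  have small: "norm (z * p ^ n) < 1" if "norm z < 1" for z n
    using that p by (simp add: norm_mult norm_power)
      (meson mult_left_le norm_ge_zero order.strict_trans1 power_le_one less_imp_le)
  have rec: "(1 - z) * E z = E (z * p)" if z: "norm z < 1" for z
  proof -
    have "(\<lambda>n. a n * z ^ n - a n * (z * p) ^ n) sums (E z - E (z * p))"
      unfolding E_def using small[OF z, of 1] z by (intro sums_diff summable_sums sm) auto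
    moreover have "(\<lambda>n. a n * z ^ n - a n * (z * p) ^ n) sums (z * E z + 0)"
    proof -
      have "a (Suc n) * z ^ Suc n - a (Suc n) * (z * p) ^ Suc n = z * (a n * z ^ n)" for n
      proof -
        have "qpoch p p n \<noteq> 0" "1 - p * p ^ n \<noteq> 0"
          using qpoch_nonzero[of p p "Suc n"] p by (auto simp: qpoch_Suc)
        then have "a (Suc n) * (1 - p * p ^ n) = a n"
          unfolding a_def qpoch_Suc by simp
        moreover have "a (Suc n) * z ^ Suc n - a (Suc n) * (z * p) ^ Suc n
            = a (Suc n) * (1 - p * p ^ n) * z ^ Suc n"
          by (simp add: power_mult_distrib algebra_simps)
        ultimately show ?thesis by simp
      qed
      then have "(\<lambda>n. a (Suc n) * z ^ Suc n - a (Suc n) * (z * p) ^ Suc n) sums (z * E z)"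
        unfolding E_def using z by (simp only:) (intro sums_mult summable_sums sm)
      from sums_Suc[OF this] show ?thesis by simp
    qed
    ultimately have "E z - E (z * p) = z * E z"
      using sums_unique2 by fastforce
    then show ?thesis by (simp add: algebra_simps)
  qed
  have it: "qpoch x p n * E x = E (x * p ^ n)" for n
  proof (induction n)
    case (Suc n)
    have "qpoch x p (Suc n) * E x = (1 - x * p ^ n) * (qpoch x p n * E x)"
      by (simp add: qpoch_Suc mult_ac)
    also have "\<dots> = E (x * p ^ Suc n)"
      unfolding Suc.IH rec[OF small[OF x]] by (simp add: mult_ac)
    finally show ?case .
  qed simp
  have "isCont E 0"
    unfolding E_def by (rule isCont_powser[of _ "1 / 2"]) (use sm[of "1 / 2"] in auto)
  moreover have "(\<lambda>n. x * p ^ n) \<longlonglongrightarrow> x * 0"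
    using p by (intro tendsto_intros LIMSEQ_power_zero)
  ultimately have "(\<lambda>n. E (x * p ^ n)) \<longlonglongrightarrow> E 0"
    by (intro isCont_tendsto_compose[of 0 E]) auto
  moreover have "(\<lambda>n. E (x * p ^ n)) \<longlonglongrightarrow> qpoch_inf x p * E x"
    unfolding it[symmetric] by (intro tendsto_intros qpoch_LIMSEQ p)
  moreover have "E 0 = 1"
    using powser_zero[of a] by (simp add: E_def a_def)
  ultimately have "qpoch_inf x p * E x = 1"
    using LIMSEQ_unique by fastforce
  then have "E x = 1 / qpoch_inf x p"
    by (metis mult_zero_left nonzero_eq_divide_eq mult.commute zero_neq_one)
  then show ?thesis
    using summable_sums[OF sm[OF x]] unfolding E_def a_def by simp
qed

section \<open>Uniqueness for contracting functional equations\<close>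

text \<open>The step is available for every bound \<open>K\<close>, so iterating it from
  \<open>C\<close> yields the bounds \<open>\<kappa> ^ n * C * w z y\<close>, which tend to 0.
  \<open>P\<close> describes the stable set of pairs and \<open>w\<close> is the weight.\<close>

lemma eq_0_if_contraction:
  fixes D :: "'a \<Rightarrow> 'b \<Rightarrow> complex" and w :: "'a \<Rightarrow> 'b \<Rightarrow> real"
  assumes bound: "\<And>z y. P z y \<Longrightarrow> norm (D z y) \<le> C * w z y"
    and step: "\<And>K z y. (\<And>z y. P z y \<Longrightarrow> norm (D z y) \<le> K * w z y) \<Longrightarrow> 0 \<le> K \<Longrightarrow> P z y
                 \<Longrightarrow> norm (D z y) \<le> \<kappa> * K * w z y"
    and "0 \<le> \<kappa>" "\<kappa> < 1" "0 \<le> C" "P z y"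
  shows "D z y = 0"
proof -
  have *: "\<forall>z y. P z y \<longrightarrow> norm (D z y) \<le> \<kappa> ^ n * C * w z y" for n
  proof (induction n)
    case 0
    then show ?case using bound by simp
  next
    case (Suc n)
    then show ?case using step[of "\<kappa> ^ n * C"] assms(3,5) by (simp add: mult.assoc)
  qed
  have "(\<lambda>n. \<kappa> ^ n * C * w z y) \<longlonglongrightarrow> 0 * C * w z y"
    using assms by (intro tendsto_intros LIMSEQ_power_zero) auto
  then have "norm (D z y) \<le> 0"
    using * \<open>P z y\<close> by (intro LIMSEQ_le_const) auto
  then show ?thesis by simp
qed

section \<open>Coefficients of the right-hand sides and their recurrence\<close>

text \<open>The exponent \<open>e\<close> is 2 in part (a) and 1 in part (b).\<close>

definition qsum :: "nat \<Rightarrow> complex \<Rightarrow> complex \<Rightarrow> nat \<Rightarrow> complex" where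
  "qsum e q y n = (\<Sum>k = 0..n. q ^ (e * k)
     * (qpoch (y / q) q (2 * k) / (qpoch (q ^ 2) (q ^ 2) k * qpoch (y ^ 2) (q ^ 2) k)))"

text \<open>The power q^(n^2+n) of part (a) is kept out of the coefficient, so that one recurrence
  in \<open>e\<close> covers both parts.\<close>

definition qcoef :: "nat \<Rightarrow> complex \<Rightarrow> complex \<Rightarrow> nat \<Rightarrow> complex" where
  "qcoef e q y n = (qpoch (- y) q n / qpoch (y * q ^ n) q (n + 1)) * qsum e q y n"

context
  fixes q :: complex
  assumes q0: "0 < norm q" and q1: "norm q < 1"
begin

lemma q_nonzero: "q \<noteq> 0" using q0 by auto

lemma norm_q2: "norm (q ^ 2) < 1"
  using q1 by (simp add: norm_power power_less_one_iff)

lemma qpoch_q2_nonzero: "qpoch (q ^ 2) (q ^ 2) n \<noteq> 0"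
  using norm_q2 by (intro qpoch_nonzero) auto

lemma norm_sq_less: "norm (y ^ 2) < 1" if "norm y < 1" for y :: complex
  using that by (simp add: norm_power power_less_one_iff)

text \<open>The summand for yq contains (y;q)_(2k), while the summand for y contains (y/q;q)_(2k). A
  combination of the two, with the index shifted by one, is the difference of consecutive values of
  a closed product \<open>U\<close>, so the sums telescope.\<close>

lemma qsum_Suc_shift:
  assumes y: "norm y < 1" and e: "e = 1 \<or> e = 2"
  shows "(1 + y) * qsum e q y (Suc n)
       = q ^ ((2 - e) * Suc n) * ((1 + y) * qpoch y q (2 * Suc n)
           / (qpoch (q ^ 2) (q ^ 2) (Suc n) * qpoch (y ^ 2) (q ^ 2) (Suc n)))
         + y ^ (e - 1) * qsum e q (y * q) n"
proof -
  define T where "T y k = q ^ (e * k) * (qpoch (y / q) q (2 * k)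
     / (qpoch (q ^ 2) (q ^ 2) k * qpoch (y ^ 2) (q ^ 2) k))" for y k
  define U where "U n = q ^ ((2 - e) * n) * ((1 + y) * qpoch y q (2 * n)
           / (qpoch (q ^ 2) (q ^ 2) n * qpoch (y ^ 2) (q ^ 2) n))" for n
  have y2: "qpoch (y ^ 2) (q ^ 2) n \<noteq> 0" for n
    using norm_sq_less[OF y] norm_q2 by (intro qpoch_nonzero) auto
  \<comment> \<open>The termwise form of the telescoping: \<open>U (Suc n) - U n\<close> is the
    summand for y at \<open>Suc n\<close>, times 1 + y, minus the scaled summand for yq at
    \<open>n\<close>.\<close>
  have step: "(1 + y) * T y (Suc n) + U n = U (Suc n) + y ^ (e - 1) * T (y * q) n" for n
  proof -
    define Q where "Q = q ^ n"
    define a where "a = qpoch y q (2 * n)"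
    define b where "b = qpoch (q ^ 2) (q ^ 2) n"
    define c where "c = qpoch (y ^ 2) (q ^ 2) n"
    define c' where "c' = qpoch ((y * q) ^ 2) (q ^ 2) n"
    have b1: "qpoch (q ^ 2) (q ^ 2) (Suc n) = b * (1 - q ^ 2 * Q ^ 2)"
      by (simp add: b_def qpoch_Suc Q_def flip: power_mult) (simp add: mult.commute)
    have c1: "qpoch (y ^ 2) (q ^ 2) (Suc n) = c * (1 - y ^ 2 * Q ^ 2)"
      by (simp add: c_def qpoch_Suc Q_def flip: power_mult) (simp add: mult.commute)
    have c2: "qpoch (y ^ 2) (q ^ 2) (Suc n) = (1 - y ^ 2) * c'"
      unfolding c'_def by (subst qpoch_Suc_shift) (simp add: power_mult_distrib)
    have a1: "qpoch y q (2 * Suc n) = a * (1 - y * Q ^ 2) * (1 - y * q * Q ^ 2)"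
      by (simp add: a_def qpoch_Suc Q_def flip: power_mult) (simp add: mult.commute mult.left_commute)
    have a2: "qpoch (y / q) q (2 * Suc n) = (1 - y / q) * (a * (1 - y * Q ^ 2))"
      using q_nonzero
      by (simp add: qpoch_Suc_shift[of "y / q"] a_def qpoch_Suc[of y] Q_def flip: power_mult) (simp add: mult.commute)
    have nz: "b \<noteq> 0" "1 - q ^ 2 * Q ^ 2 \<noteq> 0" "c \<noteq> 0" "1 - y ^ 2 * Q ^ 2 \<noteq> 0" "1 - y ^ 2 \<noteq> 0" "c' \<noteq> 0"
      using qpoch_q2_nonzero[of "Suc n"] y2[of "Suc n"] c2 unfolding b1 c1 by auto
    \<comment> \<open>(y^2;q^2)_(n+1) was split off at its last factor in \<open>c1\<close> and at
      its first factor in \<open>c2\<close>; comparing the two expresses \<open>c'\<close> through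
      \<open>c\<close>.\<close>
    have cc: "c' = c * (1 - y ^ 2 * Q ^ 2) / (1 - y ^ 2)"
      using c1 c2 nz by (simp add: field_simps)
    have T': "T (y * q) n = Q ^ e * (a / (b * c'))"
      using q_nonzero
      by (simp add: T_def a_def b_def c'_def Q_def flip: power_mult) (simp add: mult.commute)
    have Un: "U n = Q ^ (2 - e) * ((1 + y) * a / (b * c))"
      by (simp add: U_def a_def b_def c_def Q_def flip: power_mult) (simp add: mult.commute)
    have US: "U (Suc n) = (q * Q) ^ (2 - e) * ((1 + y) * (a * (1 - y * Q ^ 2) * (1 - y * q * Q ^ 2))
        / (b * (1 - q ^ 2 * Q ^ 2) * (c * (1 - y ^ 2 * Q ^ 2))))"
    proof -
      have "q ^ ((2 - e) * Suc n) = (q * Q) ^ (2 - e)"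
        by (simp add: Q_def mult.commute flip: power_mult power_Suc)
      then show ?thesis unfolding U_def a1 b1 c1 by simp
    qed
    have TS: "T y (Suc n) = (q * Q) ^ e * ((1 - y / q) * (a * (1 - y * Q ^ 2))
        / (b * (1 - q ^ 2 * Q ^ 2) * (c * (1 - y ^ 2 * Q ^ 2))))"
    proof -
      have "q ^ (e * Suc n) = (q * Q) ^ e"
        by (simp add: Q_def mult.commute flip: power_mult power_Suc)
      then show ?thesis unfolding T_def a2 b1 c1 by simp
    qed
    \<comment> \<open>All four terms of \<open>step\<close> are multiples of \<open>A\<close>. What
      is left is an elementary identity in y, q and Q = q^n, checked for each of the two values of
      \<open>e\<close>.\<close>
    define A where "A = a / (b * (1 - q ^ 2 * Q ^ 2) * (c * (1 - y ^ 2 * Q ^ 2)))"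
    have 1: "T y (Suc n) = (q * Q) ^ e * ((1 - y / q) * (1 - y * Q ^ 2)) * A"
      unfolding TS A_def by simp
    have 2: "U (Suc n) = (q * Q) ^ (2 - e) * (1 + y) * ((1 - y * Q ^ 2) * (1 - y * q * Q ^ 2)) * A"
      unfolding US A_def by simp
    have 3: "U n = Q ^ (2 - e) * (1 + y) * ((1 - q ^ 2 * Q ^ 2) * (1 - y ^ 2 * Q ^ 2)) * A"
      unfolding Un A_def using nz by simp
    have 4: "T (y * q) n = Q ^ e * ((1 - y ^ 2) * (1 - q ^ 2 * Q ^ 2)) * A"
      unfolding T' A_def cc using nz by simp
    have "(1 + y) * ((q * Q) ^ e * ((1 - y / q) * (1 - y * Q ^ 2)))
        + Q ^ (2 - e) * (1 + y) * ((1 - q ^ 2 * Q ^ 2) * (1 - y ^ 2 * Q ^ 2))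
        = (q * Q) ^ (2 - e) * (1 + y) * ((1 - y * Q ^ 2) * (1 - y * q * Q ^ 2))
        + y ^ (e - 1) * (Q ^ e * ((1 - y ^ 2) * (1 - q ^ 2 * Q ^ 2)))"
      using e q_nonzero by (auto simp: field_simps) (simp_all add: algebra_simps power2_eq_square)
    from arg_cong[OF this, of "\<lambda>t. t * A"] show ?thesis
      unfolding 1 2 3 4 by (simp only: distrib_right mult.assoc)
  qed
  have qs: "qsum e q y n = (\<Sum>k = 0..n. T y k)" for y n
    by (simp add: qsum_def T_def)
  have "(1 + y) * (\<Sum>k = 0..Suc n. T y k) = U (Suc n) + y ^ (e - 1) * (\<Sum>k = 0..n. T (y * q) k)"
  proof (induction n)
    case 0
    \<comment> \<open>Since \<open>(1 + y) * T y 0\<close> equals \<open>U 0\<close>, the two cancel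
      and the telescoping leaves no term from the lower end.\<close>
    have "T y 0 = 1" "U 0 = 1 + y" by (simp_all add: T_def U_def)
    then show ?case using step[of 0] by (simp add: algebra_simps)
  next
    case (Suc n)
    have "(1 + y) * (\<Sum>k = 0..Suc (Suc n). T y k)
        = U (Suc n) + y ^ (e - 1) * (\<Sum>k = 0..n. T (y * q) k) + (1 + y) * T y (Suc (Suc n))"
      by (simp only: sum.atLeast0_atMost_Suc[of _ "Suc n"] distrib_left Suc.IH)
    also have "\<dots> = ((1 + y) * T y (Suc (Suc n)) + U (Suc n)) + y ^ (e - 1) * (\<Sum>k = 0..n. T (y * q) k)"
      by simp
    also have "\<dots> = U (Suc (Suc n)) + y ^ (e - 1) * (\<Sum>k = 0..Suc n. T (y * q) k)"
      by (simp only: step) (simp add: distrib_left)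
    finally show ?case .
  qed
  then show ?thesis unfolding qs U_def .
qed

lemma qcoef_0: "qcoef e q y 0 = 1 / (1 - y)"
  by (simp add: qcoef_def qsum_def qpoch_Suc)

text \<open>The factorizations (y;q)_(2N) = (y;q)_N (y q^N;q)_N and (y^2;q^2)_N = (y;q)_N (-y;q)_N
  make the closed product of \<open>qsum_Suc_shift\<close> cancel against the prefactor of
  \<open>qcoef\<close>. Only a power of q over (q^2;q^2)_N survives, which is what Euler's
  expansions sum.\<close>

lemma qcoef_Suc:
  assumes y: "norm y < 1" and e: "e = 1 \<or> e = 2"
  shows "(1 - y * q ^ (2 * Suc n)) * qcoef e q y (Suc n)
       = q ^ ((2 - e) * Suc n) / qpoch (q ^ 2) (q ^ 2) (Suc n) + y ^ (e - 1) * qcoef e q (y * q) n"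
proof -
  define N where "N = Suc n"
  define a where "a = qpoch y q N"
  define a' where "a' = qpoch (- y) q N"
  define d where "d = qpoch (y * q ^ N) q N"
  define m where "m = qpoch (- y * q) q n"
  have small: "norm (y * q ^ k) < 1" for k
    using y q1 by (simp add: norm_mult norm_power)
      (meson mult_left_le norm_ge_zero order.strict_trans1 power_le_one less_imp_le)
  have nz: "a \<noteq> 0" "a' \<noteq> 0" "d \<noteq> 0" "1 + y \<noteq> 0" "1 - y * q ^ (2 * N) \<noteq> 0"
    using y q1 qpoch_nonzero[of y q] qpoch_nonzero[of "- y" q] qpoch_nonzero[OF small] small[of "2 * N"]
    by (auto simp: a_def a'_def d_def add_eq_0_iff)
  have d1: "qpoch (y * q ^ N) q (N + 1) = d * (1 - y * q ^ (2 * N))"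
    by (simp add: d_def qpoch_Suc mult.assoc mult_2 flip: power_add)
  have a'm: "a' = (1 + y) * m"
    unfolding a'_def m_def N_def by (subst qpoch_Suc_shift) simp
  have "qpoch y q (2 * N) = a * d"
    unfolding a_def d_def by (metis mult_2 qpoch_add)
  moreover have "qpoch (y ^ 2) (q ^ 2) N = a * a'"
    unfolding a_def a'_def by (rule qpoch_square)
  ultimately have "(1 + y) * qsum e q y N = q ^ ((2 - e) * N) * ((1 + y) * (a * d) /
      (qpoch (q ^ 2) (q ^ 2) N * (a * a'))) + y ^ (e - 1) * qsum e q (y * q) n"
    using qsum_Suc_shift[OF y e, of n] unfolding N_def by simp
  then have S: "m * ((1 + y) * qsum e q y N) = q ^ ((2 - e) * N) * d / qpoch (q ^ 2) (q ^ 2) N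
      + y ^ (e - 1) * m * qsum e q (y * q) n"
    using nz a'm by (simp add: distrib_left)
  have "(1 - y * q ^ (2 * N)) * qcoef e q y N = a' * qsum e q y N / d"
    unfolding qcoef_def d1 using nz by (simp add: a'_def)
  also have "\<dots> = (q ^ ((2 - e) * N) * d / qpoch (q ^ 2) (q ^ 2) N
      + y ^ (e - 1) * m * qsum e q (y * q) n) / d"
    unfolding S[symmetric] a'm by (simp add: mult_ac)
  also have "\<dots> = q ^ ((2 - e) * N) / qpoch (q ^ 2) (q ^ 2) N + y ^ (e - 1) * (m * qsum e q (y * q) n / d)"
    using nz by (simp add: add_divide_distrib)
  \<comment> \<open>For yq and index \<open>n\<close> the denominator starts at y q q^n = y q^N and
    has n + 1 = N factors, so it is again \<open>d\<close>.\<close>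
  also have "m * qsum e q (y * q) n / d = qcoef e q (y * q) n"
    by (simp add: qcoef_def m_def d_def N_def mult.assoc)
  finally show ?thesis unfolding N_def .
qed

text \<open>Uniformity in y matters because the functional equation also evaluates the series at yq.
  The numerator argument y/q may lie outside the unit disc, but there an upper bound suffices; the
  denominators have arguments of norm below 1. The remaining sum is dominated by a geometric series
  in |q|.\<close>

lemma qcoef_bounded:
  assumes "1 \<le> e" "0 \<le> \<rho>" "\<rho> < 1"
  obtains K where "0 \<le> K" "\<And>y n. norm y \<le> \<rho> \<Longrightarrow> norm (qcoef e q y n) \<le> K"
proof
  define cT where "cT = exp (\<rho> / norm q / (1 - norm q))"
  define cB where "cB = exp (- (norm (q ^ 2) / (1 - norm (q ^ 2)) / (1 - norm (q ^ 2))))"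
  define cC where "cC = exp (- (\<rho> / (1 - \<rho>) / (1 - norm (q ^ 2))))"
  define cA where "cA = exp (\<rho> / (1 - norm q))"
  define cD where "cD = exp (- (\<rho> / (1 - \<rho>) / (1 - norm q)))"
  define M where "M = cT / (cB * cC)"
  have pos: "0 < cT" "0 < cB" "0 < cC" "0 < cA" "0 < cD" "0 < M"
    by (simp_all add: cT_def cB_def cC_def cA_def cD_def M_def)
  show "0 \<le> cA / cD * (M * (1 / (1 - norm q)))"
    using pos q1 by simp
  fix y :: complex and n :: nat
  assume y: "norm y \<le> \<rho>"
  have T: "norm (qpoch (y / q) q k) \<le> cT" for k
    using norm_qpoch_le[OF q1, of "y / q" k] y q0 q1
    by (rule_tac order_trans) (auto simp: cT_def norm_divide intro!: divide_right_mono)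
  have B: "cB \<le> norm (qpoch (q ^ 2) (q ^ 2) k)" for k
    unfolding cB_def by (rule norm_qpoch_ge) (use norm_q2 in auto)
  have y2: "norm (y ^ 2) \<le> \<rho>"
    using y assms mult_mono[OF y, of "norm y" 1] by (simp add: norm_mult power2_eq_square)
  have C: "cC \<le> norm (qpoch (y ^ 2) (q ^ 2) k)" for k
    unfolding cC_def by (rule norm_qpoch_ge) (use norm_q2 y2 assms in auto)
  have "norm (qsum e q y n) \<le> (\<Sum>k = 0..n. M * norm q ^ k)"
    unfolding qsum_def
  proof (rule sum_norm_le)
    fix k
    have "norm q ^ (e * k) \<le> norm q ^ k"
      using assms q0 q1 by (intro power_decreasing) auto
    moreover have "norm (qpoch (y / q) q (2 * k)) / (norm (qpoch (q ^ 2) (q ^ 2) k) * norm (qpoch (y ^ 2) (q ^ 2) k)) \<le> M"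
      unfolding M_def using pos by (intro frac_le mult_mono T B C) auto
    ultimately show "norm (q ^ (e * k) * (qpoch (y / q) q (2 * k) / (qpoch (q ^ 2) (q ^ 2) k * qpoch (y ^ 2) (q ^ 2) k)))
        \<le> M * norm q ^ k"
      unfolding norm_mult norm_divide norm_power[of q "e * k"]
      by (subst mult.commute[of M]) (intro mult_mono, auto)
  qed
  also have "\<dots> \<le> M * (1 / (1 - norm q))"
    using sum_power_le[of "norm q" "Suc n"] q1 pos
    by (simp only: sum_distrib_left[symmetric] atLeast0AtMost lessThan_Suc_atMost) (intro mult_left_mono, auto)
  finally have S: "norm (qsum e q y n) \<le> M * (1 / (1 - norm q))" .
  have A: "norm (qpoch (- y) q n) \<le> cA"
    using norm_qpoch_le[OF q1, of "- y" n] y q1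
    by (rule_tac order_trans) (auto simp: cA_def intro!: divide_right_mono)
  have "norm (y * q ^ n) \<le> \<rho>"
    using y q1 by (simp add: norm_mult norm_power)
      (meson mult_left_le norm_ge_zero order.trans power_le_one less_imp_le)
  then have D: "cD \<le> norm (qpoch (y * q ^ n) q (n + 1))"
    unfolding cD_def by (rule norm_qpoch_ge) (use q1 assms in auto)
  show "norm (qcoef e q y n) \<le> cA / cD * (M * (1 / (1 - norm q)))"
    unfolding qcoef_def norm_mult norm_divide
    using pos by (intro mult_mono frac_le A D S) auto
qed

text \<open>Euler's expansion of the product itself, in base q^2. The series satisfies E(z) = (1 + z
  q^2) E(z q^2), and iteration with continuity at 0 identifies it with the product for every
  z.\<close>

lemma euler_sum_square:
  "(\<lambda>n. q ^ (n ^ 2 + n) / qpoch (q ^ 2) (q ^ 2) n * z ^ n) sums qpoch_inf (- z * q ^ 2) (q ^ 2)"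
proof -
  define a where "a n = q ^ (n ^ 2 + n) / qpoch (q ^ 2) (q ^ 2) n" for n
  define E where "E z = (\<Sum>n. a n * z ^ n)" for z
  define cB where "cB = exp (- (norm (q ^ 2) / (1 - norm (q ^ 2)) / (1 - norm (q ^ 2))))"
  have B: "cB \<le> norm (qpoch (q ^ 2) (q ^ 2) k)" for k
    unfolding cB_def by (rule norm_qpoch_ge) (use norm_q2 in auto)
  have cB: "0 < cB" by (simp add: cB_def)
  have sm: "summable (\<lambda>n. a n * z ^ n)" for z
  proof (rule summable_comparison_test')
    show "summable (\<lambda>n. 1 / cB * (norm q ^ (n ^ 2 + n) * norm z ^ n))"
      using q1 by (intro summable_mult summable_power_square) auto
    fix n
    show "norm (a n * z ^ n) \<le> 1 / cB * (norm q ^ (n ^ 2 + n) * norm z ^ n)"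
      using frac_le[OF _ order_refl cB B, of "norm q ^ (n ^ 2 + n) * norm z ^ n" n]
      by (simp add: a_def norm_mult norm_divide norm_power)
  qed
  have a0: "a 0 = 1" by (simp add: a_def)
  have rec: "E z = (1 - (- z * q ^ 2)) * E (z * q ^ 2)" for z
  proof -
    have "(\<lambda>n. a n * z ^ n - a n * (z * q ^ 2) ^ n) sums (E z - E (z * q ^ 2))"
      unfolding E_def by (intro sums_diff summable_sums sm)
    moreover have "(\<lambda>n. a n * z ^ n - a n * (z * q ^ 2) ^ n) sums (z * q ^ 2 * E (z * q ^ 2) + 0)"
    proof -
      have "a (Suc n) * z ^ Suc n - a (Suc n) * (z * q ^ 2) ^ Suc n = z * q ^ 2 * (a n * (z * q ^ 2) ^ n)" for n
      proof -
        have nz: "qpoch (q ^ 2) (q ^ 2) n \<noteq> 0" "1 - q ^ 2 * (q ^ 2) ^ n \<noteq> 0"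
          using qpoch_q2_nonzero[of "Suc n"] by (auto simp: qpoch_Suc)
        have "(Suc n) ^ 2 + Suc n = n ^ 2 + n + 2 + 2 * n"
          by (simp add: power2_eq_square)
        then have "q ^ ((Suc n) ^ 2 + Suc n) = q ^ (n ^ 2 + n) * q ^ 2 * (q ^ 2) ^ n"
          by (simp only: power_add power_mult)
        then have "a (Suc n) * (1 - q ^ 2 * (q ^ 2) ^ n) = q ^ 2 * (q ^ 2) ^ n * a n"
          using nz unfolding a_def qpoch_Suc by simp
        moreover have "a (Suc n) * z ^ Suc n - a (Suc n) * (z * q ^ 2) ^ Suc n
            = a (Suc n) * (1 - q ^ 2 * (q ^ 2) ^ n) * z ^ Suc n"
          by (simp add: power_mult_distrib algebra_simps)
        ultimately show ?thesis
          by (simp add: power_mult_distrib mult_ac)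
      qed
      then have "(\<lambda>n. a (Suc n) * z ^ Suc n - a (Suc n) * (z * q ^ 2) ^ Suc n) sums (z * q ^ 2 * E (z * q ^ 2))"
        unfolding E_def by (simp only:) (intro sums_mult summable_sums sm)
      from sums_Suc[OF this] show ?thesis by simp
    qed
    ultimately have "E z - E (z * q ^ 2) = z * q ^ 2 * E (z * q ^ 2)"
      using sums_unique2 by fastforce
    then show ?thesis by (simp add: algebra_simps)
  qed
  have it: "E z = qpoch (- z * q ^ 2) (q ^ 2) n * E (z * (q ^ 2) ^ n)" for n
  proof (induction n)
    case (Suc n)
    then show ?case by (subst (asm) rec) (simp add: qpoch_Suc mult_ac)
  qed simp
  have "isCont E 0"
    unfolding E_def by (rule isCont_powser[of _ 1]) (use sm[of 1] in auto)
  moreover have "(\<lambda>n. z * (q ^ 2) ^ n) \<longlonglongrightarrow> z * 0"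
    using norm_q2 by (intro tendsto_intros LIMSEQ_power_zero)
  ultimately have "(\<lambda>n. E (z * (q ^ 2) ^ n)) \<longlonglongrightarrow> E 0"
    by (intro isCont_tendsto_compose[of 0 E]) auto
  then have "(\<lambda>n. qpoch (- z * q ^ 2) (q ^ 2) n * E (z * (q ^ 2) ^ n))
      \<longlonglongrightarrow> qpoch_inf (- z * q ^ 2) (q ^ 2) * E 0"
    by (intro tendsto_intros qpoch_LIMSEQ norm_q2)
  then have "E z = qpoch_inf (- z * q ^ 2) (q ^ 2) * E 0"
    unfolding it[symmetric] by (simp add: LIMSEQ_const_iff)
  also have "E 0 = 1" unfolding E_def using a0 by simp
  finally show ?thesis
    using summable_sums[OF sm[of z]] unfolding E_def a_def by simp
qed

section \<open>Part (a): equality of the two series by contraction\<close>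

lemma product_series_identity:
  assumes y: "norm y < 1"
  defines "F \<equiv> \<lambda>z n. qpoch (- z * q ^ (n + 1)) q n * qpoch_inf (- z * q ^ (2 * n + 2)) (q ^ 2)"
  defines "A \<equiv> \<lambda>y n. q ^ (n ^ 2 + n) * qcoef 2 q y n"
  shows "summable (\<lambda>n. y ^ n * F z n)" (is ?s1)
    and "summable (\<lambda>n. A y n * z ^ n)" (is ?s2)
    and "(\<Sum>n. y ^ n * F z n) = (\<Sum>n. A y n * z ^ n)" (is ?eq)
proof -
  \<comment> \<open>The polydisc through the given point is stable under z -> z q^2 and y -> y q,
    and all bounds below are uniform on it.\<close>
  define P where "P z' y' \<longleftrightarrow> norm z' \<le> norm z \<and> norm y' \<le> norm y" for z' y' :: complex
  define G where "G z y = (\<Sum>n. y ^ n * F z n)" for z y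
  define R where "R z y = (\<Sum>n. A y n * z ^ n)" for z y
  define b where "b = exp (norm z / (1 - norm q)) * exp (norm z / (1 - norm (q ^ 2)))"
  have mult_q: "norm (x * q ^ k) \<le> norm x" for x :: complex and k
    using q1 by (simp add: norm_mult norm_power mult_left_le power_le_one)
  have P1: "P (z' * q ^ k) (y' * q ^ l)" if "P z' y'" for z' y' k l
    using that mult_q[of z' k] mult_q[of y' l] unfolding P_def by linarith
  have P2: "P (z' * q ^ 2) y'" "P (z' * q ^ 2) (y' * q)" if "P z' y'" for z' y'
    using P1[OF that, of 2 0] P1[OF that, of 2 1] by auto
  have Fb: "norm (F z' n) \<le> b" if "P z' y'" for z' y' n
    unfolding F_def b_def norm_mult
  proof (intro mult_mono)
    show "norm (qpoch (- z' * q ^ (n + 1)) q n) \<le> exp (norm z / (1 - norm q))"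
      by (rule order_trans[OF norm_qpoch_le[OF q1]])
        (use that mult_q[of z' "n + 1"] q1 in \<open>auto simp: P_def intro!: divide_right_mono\<close>)
    show "norm (qpoch_inf (- z' * q ^ (2 * n + 2)) (q ^ 2)) \<le> exp (norm z / (1 - norm (q ^ 2)))"
      by (rule order_trans[OF norm_qpoch_inf_le[OF norm_q2]])
        (use that mult_q[of z' "2 * n + 2"] norm_q2 in \<open>auto simp: P_def intro!: divide_right_mono\<close>)
  qed auto
  have b0: "0 \<le> b" by (simp add: b_def)
  have Gt: "norm (y' ^ n * F z' n) \<le> b * norm y ^ n" if "P z' y'" for z' y' n
    unfolding norm_mult norm_power using that Fb[OF that, of n] b0
    by (subst mult.commute) (intro mult_mono power_mono, auto simp: P_def)
  have sg: "summable (\<lambda>n. b * norm y ^ n)"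
    using y by (intro summable_mult summable_geometric) auto
  have Gs: "summable (\<lambda>n. y' ^ n * F z' n)" if "P z' y'" for z' y'
    by (rule summable_comparison_test'[OF sg]) (use Gt[OF that] in auto)
  have Gb: "norm (G z' y') \<le> (\<Sum>n. b * norm y ^ n)" if "P z' y'" for z' y'
    unfolding G_def by (rule norm_suminf_le[OF Gt[OF that] sg])
  obtain K where K0: "0 \<le> K" and K: "\<And>y' n. norm y' \<le> norm y \<Longrightarrow> norm (qcoef 2 q y' n) \<le> K"
    using qcoef_bounded[of 2 "norm y"] y by auto
  have Rt: "norm (A y' n * z' ^ n) \<le> K * (norm q ^ (n ^ 2 + n) * norm z ^ n)" if "P z' y'" for z' y' n
  proof -
    have "norm (A y' n * z' ^ n) = norm (qcoef 2 q y' n) * (norm q ^ (n ^ 2 + n) * norm z' ^ n)"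
      by (simp add: A_def norm_mult norm_power)
    also have "\<dots> \<le> K * (norm q ^ (n ^ 2 + n) * norm z ^ n)"
      using that K0 by (intro mult_mono K power_mono) (auto simp: P_def)
    finally show ?thesis .
  qed
  have sr: "summable (\<lambda>n. K * (norm q ^ (n ^ 2 + n) * norm z ^ n))"
    using q1 by (intro summable_mult summable_power_square) auto
  have Rs: "summable (\<lambda>n. A y' n * z' ^ n)" if "P z' y'" for z' y'
    by (rule summable_comparison_test'[OF sr]) (use Rt[OF that] in auto)
  have Rb: "norm (R z' y') \<le> (\<Sum>n. K * (norm q ^ (n ^ 2 + n) * norm z ^ n))" if "P z' y'" for z' y'
    unfolding R_def by (rule norm_suminf_le[OF Rt[OF that] sr])
  have G: "G z' y' = qpoch_inf (- z' * q ^ 2) (q ^ 2) + y' * (G (z' * q ^ 2) y' + z' * q ^ 2 * G (z' * q ^ 2) (y' * q))"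
    if "P z' y'" for z' y'
  proof -
    \<comment> \<open>After z -> z q^2 the infinite product is the one at index n + 1, and the
      finite one lacks only its first factor 1 + z q^(n+2). Against y^(n+1), the part z q^(n+2)
      produces (yq)^n, hence the value at yq.\<close>
    have F: "F z' (Suc n) = (1 + z' * q ^ (n + 2)) * F (z' * q ^ 2) n" for n
    proof -
      have *: "- z' * q ^ (Suc n + 1) * q = - (z' * q ^ 2) * q ^ (n + 1)"
        "- z' * q ^ (2 * Suc n + 2) = - (z' * q ^ 2) * q ^ (2 * n + 2)"
        by (simp_all add: eval_nat_numeral power_add)
      have "F z' (Suc n) = (1 - (- z' * q ^ (Suc n + 1))) * F (z' * q ^ 2) n"
        unfolding F_def qpoch_Suc_shift * by (rule mult.assoc)
      then show ?thesis by simp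
    qed
    have "y' ^ Suc n * F z' (Suc n) = y' * (y' ^ n * F (z' * q ^ 2) n + z' * q ^ 2 * ((y' * q) ^ n * F (z' * q ^ 2) n))" for n
      unfolding F by (simp add: power_mult_distrib power_add power2_eq_square algebra_simps)
    then have "(\<lambda>n. y' ^ Suc n * F z' (Suc n)) sums (y' * (G (z' * q ^ 2) y' + z' * q ^ 2 * G (z' * q ^ 2) (y' * q)))"
      unfolding G_def using P2[OF that] by (simp only:) (intro sums_mult sums_add summable_sums Gs)
    from sums_Suc[OF this] have "G z' y' = y' * (G (z' * q ^ 2) y' + z' * q ^ 2 * G (z' * q ^ 2) (y' * q)) + F z' 0"
      unfolding G_def by (simp add: sums_iff)
    then show ?thesis by (simp add: F_def power2_eq_square)
  qed
  have R: "R z' y' = qpoch_inf (- z' * q ^ 2) (q ^ 2) + y' * (R (z' * q ^ 2) y' + z' * q ^ 2 * R (z' * q ^ 2) (y' * q))"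
    if "P z' y'" for z' y'
  proof -
    define f where "f n = q ^ (n ^ 2 + n) / qpoch (q ^ 2) (q ^ 2) n * z' ^ n" for n
    \<comment> \<open>The terms of R(z,y) - y R(z q^2,y) minus the Euler series. By
      \<open>qcoef_Suc\<close> the term at \<open>Suc n\<close> is a multiple of the n-th term of
      R(z q^2,yq), and the term at 0 vanishes because 1/(1-y) - y/(1-y) = 1.\<close>
    define h where "h n = A y' n * z' ^ n - y' * (A y' n * (z' * q ^ 2) ^ n) - f n" for n
    have y1: "norm y' < 1" using that y by (simp add: P_def)
    have hs: "h sums (R z' y' - y' * R (z' * q ^ 2) y' - qpoch_inf (- z' * q ^ 2) (q ^ 2))"
      unfolding h_def f_def R_def
      by (intro sums_diff sums_mult summable_sums euler_sum_square Rs P2 that)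
    have "y' \<noteq> 1" using y1 by auto
    then have h0: "h 0 = 0"
      by (simp add: h_def f_def A_def qcoef_0 field_simps)
    have "h (Suc n) = y' * (z' * q ^ 2) * (A (y' * q) n * (z' * q ^ 2) ^ n)" for n
    proof -
      have "(Suc n) ^ 2 + Suc n = n ^ 2 + n + 2 + 2 * n"
        by (simp add: power2_eq_square)
      then have qq: "q ^ ((Suc n) ^ 2 + Suc n) = q ^ (n ^ 2 + n) * q ^ 2 * (q ^ 2) ^ n"
        by (simp only: power_add power_mult)
      have "h (Suc n) = q ^ ((Suc n) ^ 2 + Suc n) * z' ^ Suc n * ((1 - y' * q ^ (2 * Suc n)) * qcoef 2 q y' (Suc n)
          - 1 / qpoch (q ^ 2) (q ^ 2) (Suc n))"
        unfolding h_def f_def A_def power_mult[of q 2] power_mult_distrib by (simp add: algebra_simps)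
      also have "\<dots> = q ^ ((Suc n) ^ 2 + Suc n) * z' ^ Suc n * (y' * qcoef 2 q (y' * q) n)"
        by (subst qcoef_Suc[OF y1]) simp_all
      also have "\<dots> = y' * (z' * q ^ 2) * (A (y' * q) n * (z' * q ^ 2) ^ n)"
        unfolding qq A_def power_mult_distrib by simp
      finally show ?thesis .
    qed
    then have "(\<lambda>n. h (Suc n)) sums (y' * (z' * q ^ 2) * R (z' * q ^ 2) (y' * q))"
      unfolding R_def by (simp only:) (intro sums_mult summable_sums Rs P2 that)
    from sums_unique2[OF sums_Suc[OF this] hs] h0 show ?thesis
      by (simp add: algebra_simps)
  qed
  \<comment> \<open>The solution of (1 + c) |q^2| = c. With s = |z q^2| it gives (1 + s) exp(c s)
    \<le> exp((1 + c) s) = exp(c |z|): the weight absorbs the factor 1 + s and leaves the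
    contraction constant |y|.\<close>
  define c where "c = norm (q ^ 2) / (1 - norm (q ^ 2))"
  define C where "C = (\<Sum>n. b * norm y ^ n) + (\<Sum>n. K * (norm q ^ (n ^ 2 + n) * norm z ^ n))"
  have c0: "0 \<le> c" using norm_q2 by (simp add: c_def)
  have C0: "0 \<le> C"
    unfolding C_def by (intro add_nonneg_nonneg suminf_nonneg sg sr) (use b0 K0 in auto)
  have Pz: "P z y" by (simp add: P_def)
  have "G z y - R z y = 0"
  proof (rule eq_0_if_contraction[where D = "\<lambda>z y. G z y - R z y" and P = P and C = C and \<kappa> = "norm y"
        and w = "\<lambda>z y. exp (c * norm z)"])
    fix z' y' assume P: "P z' y'"
    have "norm (G z' y' - R z' y') \<le> C"
      using norm_triangle_ineq4[of "G z' y'" "R z' y'"] Gb[OF P] Rb[OF P] unfolding C_def by linarith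
    also have "\<dots> \<le> C * exp (c * norm z')"
      using C0 c0 by (simp add: mult_le_cancel_left1)
    finally show "norm (G z' y' - R z' y') \<le> C * exp (c * norm z')" .
  next
    fix L :: real and z' y'
    assume IH: "\<And>z' y'. P z' y' \<Longrightarrow> norm (G z' y' - R z' y') \<le> L * exp (c * norm z')"
      and L: "0 \<le> L" and P: "P z' y'"
    define s where "s = norm (z' * q ^ 2)"
    have 1: "norm (G (z' * q ^ 2) y' - R (z' * q ^ 2) y') \<le> L * exp (c * s)"
      unfolding s_def by (rule IH[OF P2(1)[OF P]])
    have 2: "norm (G (z' * q ^ 2) (y' * q) - R (z' * q ^ 2) (y' * q)) \<le> L * exp (c * s)"
      unfolding s_def by (rule IH[OF P2(2)[OF P]])
    have "G z' y' - R z' y' = y' * ((G (z' * q ^ 2) y' - R (z' * q ^ 2) y')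
        + z' * q ^ 2 * (G (z' * q ^ 2) (y' * q) - R (z' * q ^ 2) (y' * q)))"
      using G[OF P] R[OF P] by (simp add: algebra_simps)
    then have "norm (G z' y' - R z' y') = norm y' * norm ((G (z' * q ^ 2) y' - R (z' * q ^ 2) y')
        + z' * q ^ 2 * (G (z' * q ^ 2) (y' * q) - R (z' * q ^ 2) (y' * q)))"
      by (simp only: norm_mult)
    also have "\<dots> \<le> norm y * (L * exp (c * s) + s * (L * exp (c * s)))"
    proof (rule mult_mono)
      have "norm (z' * q ^ 2 * (G (z' * q ^ 2) (y' * q) - R (z' * q ^ 2) (y' * q))) \<le> s * (L * exp (c * s))"
        using 2 unfolding s_def norm_mult[of "z' * q ^ 2"] by (intro mult_left_mono) auto
      then show "norm ((G (z' * q ^ 2) y' - R (z' * q ^ 2) y')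
        + z' * q ^ 2 * (G (z' * q ^ 2) (y' * q) - R (z' * q ^ 2) (y' * q))) \<le> L * exp (c * s) + s * (L * exp (c * s))"
        by (intro order_trans[OF norm_triangle_ineq] add_mono 1)
    qed (use P in \<open>auto simp: P_def\<close>)
    also have "\<dots> = norm y * L * ((1 + s) * exp (c * s))"
      by (simp add: algebra_simps)
    also have "\<dots> \<le> norm y * L * exp (c * norm z')"
    proof (intro mult_left_mono)
      have "(1 + s) * exp (c * s) \<le> exp s * exp (c * s)"
        by (intro mult_right_mono exp_ge_add_one_self) auto
      also have "\<dots> = exp (c * norm z')"
      proof -
        have "(1 + c) * norm (q ^ 2) = c"
          using norm_q2 by (simp add: c_def field_simps)
        moreover have "s + c * s = (1 + c) * norm (q ^ 2) * norm z'"
          by (simp add: s_def norm_mult algebra_simps)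
        ultimately have "s + c * s = c * norm z'" by simp
        then show ?thesis by (simp flip: exp_add)
      qed
      finally show "(1 + s) * exp (c * s) \<le> exp (c * norm z')" .
    qed (use L in auto)
    finally show "norm (G z' y' - R z' y') \<le> norm y * L * exp (c * norm z')" .
  qed (use y C0 Pz in auto)
  then show ?eq unfolding G_def R_def by simp
  show ?s1 by (rule Gs[OF Pz])
  show ?s2 by (rule Rs[OF Pz])
qed

end

section \<open>Part (b): the exponential weight and equality of the two series\<close>

text \<open>The first exponential is small unless \<open>Y\<close> is small, the second unless \<open>Z\<close> is;
  a small \<open>Y\<close> or \<open>Z\<close> already makes the sum of the coefficients less than 1.\<close>

lemma exponential_weight:
  fixes m t :: real
  assumes "0 \<le> m" "m < 1" "t < 1"
  obtains c \<kappa> where "0 \<le> c" "0 \<le> \<kappa>" "\<kappa> < 1"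
    "\<And>Z Y. 0 \<le> Z \<Longrightarrow> Z \<le> m \<Longrightarrow> 0 \<le> Y \<Longrightarrow> Y \<le> m \<Longrightarrow>
       Z * exp (c * (Z + Y * t)) + Y * exp (c * (Z * t + Y)) \<le> \<kappa> * exp (c * (Z + Y))"
proof
  \<comment> \<open>If one variable is at most \<open>\<epsilon>\<close>, then Z + Y \<le> m +
    \<epsilon> = \<kappa>. The constant \<open>c\<close> makes exp(-c (1-t) \<epsilon>) equal to
    \<kappa>/2, so otherwise each summand is at most \<kappa>/2.\<close>
  define \<epsilon> where "\<epsilon> = (1 - m) / 2"
  define \<kappa> where "\<kappa> = (1 + m) / 2"
  define c where "c = ln (2 / \<kappa>) / (\<epsilon> * (1 - t))"
  have pos: "0 < \<epsilon>" "0 < \<kappa>" "\<kappa> < 1" "m + \<epsilon> = \<kappa>"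
    using assms by (simp_all add: \<epsilon>_def \<kappa>_def field_simps)
  show c0: "0 \<le> c" using pos assms by (simp add: c_def)
  show "0 \<le> \<kappa>" "\<kappa> < 1" using pos by auto
  have small: "exp (- (c * (1 - t) * x)) \<le> \<kappa> / 2" if "\<epsilon> \<le> x" for x
  proof -
    have "c * (1 - t) * \<epsilon> = ln (2 / \<kappa>)" using pos assms by (simp add: c_def)
    moreover have "c * (1 - t) * \<epsilon> \<le> c * (1 - t) * x"
      using that c0 assms by (intro mult_left_mono) auto
    ultimately have "exp (- (c * (1 - t) * x)) \<le> exp (- ln (2 / \<kappa>))" by simp
    also have "\<dots> = \<kappa> / 2" using pos by (simp add: exp_minus)
    finally show ?thesis .
  qed
  fix Z Y assume h: "0 \<le> Z" "Z \<le> m" "0 \<le> Y" "Y \<le> m"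
  have le1: "exp (- (c * (1 - t) * x)) \<le> 1" if "0 \<le> x" for x
    using that c0 assms by simp
  \<comment> \<open>The claim divided by \<open>exp (c * (Z + Y))\<close>.\<close>
  have "Z * exp (- (c * (1 - t) * Y)) + Y * exp (- (c * (1 - t) * Z)) \<le> \<kappa>"
  proof (cases "Y \<le> \<epsilon> \<or> Z \<le> \<epsilon>")
    case True
    have "Z * exp (- (c * (1 - t) * Y)) + Y * exp (- (c * (1 - t) * Z)) \<le> Z * 1 + Y * 1"
      using h by (intro add_mono mult_left_mono le1)
    then show ?thesis using True h pos by linarith
  next
    case False
    have "Z * exp (- (c * (1 - t) * Y)) + Y * exp (- (c * (1 - t) * Z)) \<le> 1 * (\<kappa> / 2) + 1 * (\<kappa> / 2)"
      using h assms False by (intro add_mono mult_mono small) auto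
    then show ?thesis by simp
  qed
  from mult_right_mono[OF this, of "exp (c * (Z + Y))"]
  show "Z * exp (c * (Z + Y * t)) + Y * exp (c * (Z * t + Y)) \<le> \<kappa> * exp (c * (Z + Y))"
    by (simp add: distrib_right mult.assoc flip: exp_add) (simp add: algebra_simps)
qed

context
  fixes q :: complex
  assumes q0: "0 < norm q" and q1: "norm q < 1"
begin

lemma reciprocal_product_series_identity:
  assumes y: "norm y < 1" and z: "norm (z * q) < 1"
  defines "F \<equiv> \<lambda>z n. 1 / (qpoch (z * q ^ (n + 1)) q (n + 2) * qpoch_inf (z * q ^ (2 * n + 4)) (q ^ 2))"
  shows "summable (\<lambda>n. y ^ n * F z n)" (is ?s1)
    and "summable (\<lambda>n. qcoef 1 q y n * (q * z) ^ n)" (is ?s2)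
    and "(\<Sum>n. y ^ n * F z n) = (\<Sum>n. qcoef 1 q y n * (q * z) ^ n)" (is ?eq)
proof -
  define r where "r = norm (z * q)"
  \<comment> \<open>Bounding z' through |z' q| \<le> r < 1 keeps all arguments z' q^(k+1) in a disc
    of radius below 1, so every denominator is bounded away from zero.\<close>
  define P where "P z' y' \<longleftrightarrow> norm (z' * q) \<le> r \<and> norm y' \<le> norm y" for z' y' :: complex
  define G where "G z y = (\<Sum>n. y ^ n * F z n)" for z y
  define R where "R z y = (\<Sum>n. qcoef 1 q y n * (q * z) ^ n)" for z y
  have r: "0 \<le> r" "r < 1" using z by (simp_all add: r_def)
  define b where "b = 1 / (exp (- (r / (1 - r) / (1 - norm q))) * exp (- (r / (1 - r) / (1 - norm (q ^ 2)))))"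
  have mult_q: "norm (x * q ^ k) \<le> norm x" for x :: complex and k
    using q1 by (simp add: norm_mult norm_power mult_left_le power_le_one)
  have P1: "P (z' * q ^ k) (y' * q ^ l)" if "P z' y'" for z' y' k l
    using that mult_q[of "z' * q" k] mult_q[of y' l] unfolding P_def by (simp add: mult_ac)
  have P2: "P (z' * q ^ 2) y'" "P z' (y' * q)" if "P z' y'" for z' y'
    using P1[OF that, of 2 0] P1[OF that, of 0 1] by auto
  have zr: "norm (z' * q ^ Suc k) \<le> r" if "P z' y'" for z' y' k
    using that mult_q[of "z' * q" k] unfolding P_def by (simp add: mult_ac)
  have Fb: "norm (F z' n) \<le> b" if "P z' y'" for z' y' n
    unfolding F_def b_def norm_mult norm_divide norm_one
  proof (intro frac_le mult_mono)
    show "exp (- (r / (1 - r) / (1 - norm q))) \<le> norm (qpoch (z' * q ^ (n + 1)) q (n + 2))"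
      using zr[OF that, of n] r q1 by (intro norm_qpoch_ge) auto
    show "exp (- (r / (1 - r) / (1 - norm (q ^ 2)))) \<le> norm (qpoch_inf (z' * q ^ (2 * n + 4)) (q ^ 2))"
      using zr[OF that, of "2 * n + 3"] r norm_q2[OF q0 q1]
      by (intro norm_qpoch_inf_ge) (auto simp: eval_nat_numeral)
  qed auto
  have b0: "0 \<le> b" by (simp add: b_def)
  have Gt: "norm (y' ^ n * F z' n) \<le> b * norm y ^ n" if "P z' y'" for z' y' n
    unfolding norm_mult norm_power using that Fb[OF that, of n] b0
    by (subst mult.commute) (intro mult_mono power_mono, auto simp: P_def)
  have sg: "summable (\<lambda>n. b * norm y ^ n)"
    using y by (intro summable_mult summable_geometric) auto
  have Gs: "summable (\<lambda>n. y' ^ n * F z' n)" if "P z' y'" for z' y'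
    by (rule summable_comparison_test'[OF sg]) (use Gt[OF that] in auto)
  have Gb: "norm (G z' y') \<le> (\<Sum>n. b * norm y ^ n)" if "P z' y'" for z' y'
    unfolding G_def by (rule norm_suminf_le[OF Gt[OF that] sg])
  obtain K where K0: "0 \<le> K" and K: "\<And>y' n. norm y' \<le> norm y \<Longrightarrow> norm (qcoef 1 q y' n) \<le> K"
    using qcoef_bounded[OF q0 q1, of 1 "norm y"] y by auto
  have Rt: "norm (qcoef 1 q y' n * (q * z') ^ n) \<le> K * r ^ n" if "P z' y'" for z' y' n
    unfolding norm_mult[of "qcoef 1 q y' n"] norm_power
    using that K0 r by (intro mult_mono K power_mono) (auto simp: P_def mult.commute)
  have sr: "summable (\<lambda>n. K * r ^ n)"
    using r by (intro summable_mult summable_geometric) auto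
  have Rs: "summable (\<lambda>n. qcoef 1 q y' n * (q * z') ^ n)" if "P z' y'" for z' y'
    by (rule summable_comparison_test'[OF sr]) (use Rt[OF that] in auto)
  have Rb: "norm (R z' y') \<le> (\<Sum>n. K * r ^ n)" if "P z' y'" for z' y'
    unfolding R_def by (rule norm_suminf_le[OF Rt[OF that] sr])
  have G: "G z' y' = 1 / qpoch_inf (z' * q ^ 2) (q ^ 2) + z' * q * G z' (y' * q) + y' * G (z' * q ^ 2) y'"
    if "P z' y'" for z' y'
  proof -
    have cancel: "a * (1 / (a * x)) = 1 / x" if "a \<noteq> 0" for a x :: complex
      using that by simp
    have nz: "1 - z' * q ^ Suc n \<noteq> 0" for n
      using zr[OF that, of n] r by auto
    \<comment> \<open>Subtracting z q G(z,yq) multiplies the n-th summand by 1 - z q^(n+1), the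
      first factor of its denominator. For index n + 1 this leaves y^(n+1) times the n-th
      \<open>F\<close> at z q^2.\<close>
    define h where "h n = y' ^ n * F z' n - z' * q * ((y' * q) ^ n * F z' n)" for n
    have hs: "h sums (G z' y' - z' * q * G z' (y' * q))"
      unfolding h_def G_def by (intro sums_diff sums_mult summable_sums Gs P2 that)
    have h: "h n = y' ^ n * ((1 - z' * q ^ Suc n) * F z' n)" for n
      by (simp add: h_def power_mult_distrib algebra_simps)
    have "h (Suc n) = y' * (y' ^ n * F (z' * q ^ 2) n)" for n
    proof -
      have *: "z' * q ^ (Suc n + 1) * q = (z' * q ^ 2) * q ^ (n + 1)"
        "z' * q ^ (2 * Suc n + 4) = (z' * q ^ 2) * q ^ (2 * n + 4)"
        by (simp_all add: eval_nat_numeral power_add)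
      have FS: "F z' (Suc n) = 1 / ((1 - z' * q ^ (Suc n + 1))
          * (qpoch (z' * q ^ 2 * q ^ (n + 1)) q (n + 2) * qpoch_inf (z' * q ^ 2 * q ^ (2 * n + 4)) (q ^ 2)))"
        unfolding F_def add_Suc[of n 2] qpoch_Suc_shift * mult.assoc[of "1 - z' * q ^ (Suc n + 1)"] ..
      have "1 - z' * q ^ (Suc n + 1) \<noteq> 0" using nz[of "Suc n"] by simp
      then have "(1 - z' * q ^ (Suc n + 1)) * F z' (Suc n) = F (z' * q ^ 2) n"
        unfolding FS by (subst cancel) (simp_all only: F_def not_False_eq_True)
      then show ?thesis unfolding h by simp
    qed
    then have "(\<lambda>n. h (Suc n)) sums (y' * G (z' * q ^ 2) y')"
      unfolding G_def by (simp only:) (intro sums_mult summable_sums Gs P2 that)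
    from sums_unique2[OF sums_Suc[OF this] hs]
    have "G z' y' - z' * q * G z' (y' * q) = y' * G (z' * q ^ 2) y' + h 0" by simp
    \<comment> \<open>The finite product at index 0 is (1 - zq)(1 - z q^2). Its first factor has
      cancelled, and the second completes the infinite product from z q^4 to z q^2.\<close>
    moreover have "h 0 = 1 / qpoch_inf (z' * q ^ 2) (q ^ 2)"
    proof -
      have "h 0 = 1 / ((1 - z' * q ^ 2) * qpoch_inf (z' * q ^ 2 * q ^ 2) (q ^ 2))"
      proof -
        have *: "qpoch (z' * q ^ (0 + 1)) q (0 + 2) = (1 - z' * q ^ Suc 0) * (1 - z' * q ^ 2)"
          "z' * q ^ (2 * 0 + 4) = z' * q ^ 2 * q ^ 2"
          by (simp_all add: qpoch_Suc eval_nat_numeral)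
        show ?thesis
          unfolding h F_def * mult.assoc[of "1 - z' * q ^ Suc 0"] cancel[OF nz] by simp
      qed
      then show ?thesis
        by (simp add: qpoch_inf_shift[OF norm_q2[OF q0 q1], of "z' * q ^ 2"])
    qed
    ultimately show ?thesis by (simp add: algebra_simps)
  qed
  have R: "R z' y' = 1 / qpoch_inf (z' * q ^ 2) (q ^ 2) + z' * q * R z' (y' * q) + y' * R (z' * q ^ 2) y'"
    if "P z' y'" for z' y'
  proof -
    define f where "f n = (z' * q ^ 2) ^ n / qpoch (q ^ 2) (q ^ 2) n" for n
    \<comment> \<open>As in part (a), the constant term vanishes and \<open>qcoef_Suc\<close> shifts
      the others; here the coefficient at yq stays with the argument z.\<close>
    define h where "h n = qcoef 1 q y' n * (q * z') ^ n - y' * (qcoef 1 q y' n * (q * (z' * q ^ 2)) ^ n) - f n" for n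
    have y1: "norm y' < 1" using that y by (simp add: P_def)
    have z1: "norm (z' * q ^ 2) < 1" using zr[OF that, of 1] r by (simp add: numeral_2_eq_2)
    have hs: "h sums (R z' y' - y' * R (z' * q ^ 2) y' - 1 / qpoch_inf (z' * q ^ 2) (q ^ 2))"
      unfolding h_def f_def R_def
      by (intro sums_diff sums_mult summable_sums euler_sum[OF z1 norm_q2[OF q0 q1]] Rs P2 that)
    have "y' \<noteq> 1" using y1 by auto
    then have h0: "h 0 = 0"
      by (simp add: h_def f_def qcoef_0[OF q0 q1] field_simps)
    have "h (Suc n) = z' * q * (qcoef 1 q (y' * q) n * (q * z') ^ n)" for n
    proof -
      have "h (Suc n) = (q * z') ^ Suc n * ((1 - y' * q ^ (2 * Suc n)) * qcoef 1 q y' (Suc n)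
          - q ^ Suc n / qpoch (q ^ 2) (q ^ 2) (Suc n))"
        unfolding h_def f_def power_mult[of q 2] power2_eq_square[of q] power_mult_distrib
        by (simp add: algebra_simps)
      also have "\<dots> = (q * z') ^ Suc n * qcoef 1 q (y' * q) n"
        by (subst qcoef_Suc[OF q0 q1 y1]) simp_all
      finally show ?thesis by simp
    qed
    then have "(\<lambda>n. h (Suc n)) sums (z' * q * R z' (y' * q))"
      unfolding R_def by (simp only:) (intro sums_mult summable_sums Rs P2 that)
    from sums_unique2[OF sums_Suc[OF this] hs] h0 show ?thesis
      by (simp add: algebra_simps)
  qed
  define m where "m = max r (norm y)"
  have m: "0 \<le> m" "m < 1" "r \<le> m" "norm y \<le> m" using r y by (auto simp: m_def)
  obtain c \<kappa> where c: "0 \<le> c" "0 \<le> \<kappa>" "\<kappa> < 1"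
    "\<And>Z Y. 0 \<le> Z \<Longrightarrow> Z \<le> m \<Longrightarrow> 0 \<le> Y \<Longrightarrow> Y \<le> m \<Longrightarrow>
       Z * exp (c * (Z + Y * norm q)) + Y * exp (c * (Z * norm q + Y)) \<le> \<kappa> * exp (c * (Z + Y))"
    by (rule exponential_weight[OF m(1,2) q1]) blast
  define C where "C = (\<Sum>n. b * norm y ^ n) + (\<Sum>n. K * r ^ n)"
  have C0: "0 \<le> C"
    unfolding C_def by (intro add_nonneg_nonneg suminf_nonneg sg sr) (use b0 K0 r in auto)
  have Pz: "P z y" by (simp add: P_def r_def)
  have "G z y - R z y = 0"
  proof (rule eq_0_if_contraction[where D = "\<lambda>z y. G z y - R z y" and P = P and C = C and \<kappa> = \<kappa>
        and w = "\<lambda>z y. exp (c * (norm (z * q) + norm y))"])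
    fix z' y' assume P: "P z' y'"
    have "norm (G z' y' - R z' y') \<le> C"
      using norm_triangle_ineq4[of "G z' y'" "R z' y'"] Gb[OF P] Rb[OF P] unfolding C_def by linarith
    also have "\<dots> \<le> C * exp (c * (norm (z' * q) + norm y'))"
      using C0 c by (simp add: mult_le_cancel_left1)
    finally show "norm (G z' y' - R z' y') \<le> C * exp (c * (norm (z' * q) + norm y'))" .
  next
    fix L :: real and z' y'
    assume IH: "\<And>z' y'. P z' y' \<Longrightarrow> norm (G z' y' - R z' y') \<le> L * exp (c * (norm (z' * q) + norm y'))"
      and L: "0 \<le> L" and P: "P z' y'"
    define Z where "Z = norm (z' * q)"
    define Y where "Y = norm y'"
    have ZY: "0 \<le> Z" "Z \<le> m" "0 \<le> Y" "Y \<le> m" using P m by (auto simp: Z_def Y_def P_def)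
    have 1: "norm (G z' (y' * q) - R z' (y' * q)) \<le> L * exp (c * (Z + Y * norm q))"
      using IH[OF P2(2)[OF P]] by (simp add: Z_def Y_def norm_mult)
    have "norm (G (z' * q ^ 2) y' - R (z' * q ^ 2) y') \<le> L * exp (c * (norm (z' * q ^ 2 * q) + Y))"
      using IH[OF P2(1)[OF P]] by (simp add: Y_def)
    also have "\<dots> \<le> L * exp (c * (Z * norm q + Y))"
    proof -
      \<comment> \<open>The shift of z gains |q|^2, but only |q| is kept, so that both shifts shrink
        their variable by the common factor in \<open>exponential_weight\<close>.\<close>
      have "norm (z' * q ^ 2 * q) \<le> Z * norm q"
        using mult_q[of "z' * q * q" 1] unfolding Z_def norm_mult[symmetric]
        by (simp add: power2_eq_square mult_ac)
      then have "c * (norm (z' * q ^ 2 * q) + Y) \<le> c * (Z * norm q + Y)"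
        using c(1) by (intro mult_left_mono) auto
      then show ?thesis using L by (intro mult_left_mono) auto
    qed
    finally have 2: "norm (G (z' * q ^ 2) y' - R (z' * q ^ 2) y') \<le> L * exp (c * (Z * norm q + Y))" .
    have "G z' y' - R z' y' = z' * q * (G z' (y' * q) - R z' (y' * q))
        + y' * (G (z' * q ^ 2) y' - R (z' * q ^ 2) y')"
      using G[OF P] R[OF P] by (simp add: algebra_simps)
    then have "norm (G z' y' - R z' y') \<le> norm (z' * q * (G z' (y' * q) - R z' (y' * q)))
        + norm (y' * (G (z' * q ^ 2) y' - R (z' * q ^ 2) y'))"
      by (simp only: norm_triangle_ineq)
    also have "\<dots> \<le> Z * (L * exp (c * (Z + Y * norm q))) + Y * (L * exp (c * (Z * norm q + Y)))"
      unfolding norm_mult[of "z' * q"] norm_mult[of y'] Z_def[symmetric] Y_def[symmetric]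
      using ZY by (intro add_mono mult_left_mono 1 2)
    also have "\<dots> = L * (Z * exp (c * (Z + Y * norm q)) + Y * exp (c * (Z * norm q + Y)))"
      by (simp add: algebra_simps)
    also have "\<dots> \<le> L * (\<kappa> * exp (c * (Z + Y)))"
      by (intro mult_left_mono c(4) ZY L)
    finally show "norm (G z' y' - R z' y') \<le> \<kappa> * L * exp (c * (norm (z' * q) + norm y'))"
      by (simp add: Z_def Y_def mult_ac)
  qed (use c C0 Pz in auto)
  then show ?eq unfolding G_def R_def by simp
  show ?s1 by (rule Gs[OF Pz])
  show ?s2 by (rule Rs[OF Pz])
qed

end

theorem theorem1p2:
  fixes q y :: complex
  assumes "0 < norm q" and "norm q < 1" and "norm y < 1"
  shows "(\<forall>z::complex.
     let L = (\<lambda>n::nat. y ^ n * qpoch (- z * q ^ (n + 1)) q n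
                       * qpoch_inf (- z * q ^ (2 * n + 2)) (q ^ 2));
         R = (\<lambda>n::nat. z ^ n * q ^ (n ^ 2 + n)
                       * (qpoch (- y) q n / qpoch (y * q ^ n) q (n + 1))
                       * (\<Sum>k = 0..n. q ^ (2 * k)
                            * (qpoch (y / q) q (2 * k)
                               / (qpoch (q ^ 2) (q ^ 2) k * qpoch (y ^ 2) (q ^ 2) k))))
     in summable L \<and> summable R \<and> (\<Sum>n. L n) = (\<Sum>n. R n))
   \<and> (\<forall>z::complex. norm (z * q) < 1 \<longrightarrow>
     (let L = (\<lambda>n::nat. y ^ (n - 1)
                       / (qpoch (z * q ^ n) q (n + 1)
                          * qpoch_inf (z * q ^ (2 * n + 2)) (q ^ 2)));
          R = (\<lambda>n::nat. (q * z) ^ n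
                       * (qpoch (- y) q n / qpoch (y * q ^ n) q (n + 1))
                       * (\<Sum>k = 0..n. q ^ k
                            * (qpoch (y / q) q (2 * k)
                               / (qpoch (q ^ 2) (q ^ 2) k * qpoch (y ^ 2) (q ^ 2) k))))
      in summable (\<lambda>m. L (Suc m)) \<and> summable R
         \<and> (\<Sum>m. L (Suc m)) = (\<Sum>n. R n)))"
proof -
  \<comment> \<open>The sum in (b) starts at 1. With n = m + 1 the truncated difference n - 1 is m,
    and the summand becomes y^m times the \<open>F\<close> of the reciprocal identity.\<close>
  have shift: "y ^ (Suc m - 1) / (qpoch (z * q ^ Suc m) q (Suc m + 1) * qpoch_inf (z * q ^ (2 * Suc m + 2)) (q ^ 2))
      = y ^ m * (1 / (qpoch (z * q ^ (m + 1)) q (m + 2) * qpoch_inf (z * q ^ (2 * m + 4)) (q ^ 2)))" for z m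
  proof -
    have "2 * Suc m + 2 = 2 * m + 4" "Suc m + 1 = m + 2" by simp_all
    then show ?thesis
      by (simp only: diff_Suc_1 times_divide_eq_right mult_1_right) (simp only: Suc_eq_plus1)
  qed
  show ?thesis
    unfolding Let_def
  proof (intro conjI allI impI, goal_cases)
    case (1 z)
    show ?case using product_series_identity(1)[OF assms, of z] by (simp only: mult.assoc)
  next
    case (2 z)
    show ?case using product_series_identity(2)[OF assms, of z]
      by (simp only: qcoef_def qsum_def mult_ac)
  next
    case (3 z)
    show ?case using product_series_identity(3)[OF assms, of z]
      by (simp only: qcoef_def qsum_def mult_ac)
  next
    case (4 z)
    show ?case using reciprocal_product_series_identity(1)[OF assms 4] by (simp only: shift)
  next
    case (5 z)
    show ?case using reciprocal_product_series_identity(2)[OF assms 5]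
      by (simp only: qcoef_def qsum_def mult_ac mult_1 mult_1_right)
  next
    case (6 z)
    show ?case using reciprocal_product_series_identity(3)[OF assms 6]
      unfolding shift by (simp only: qcoef_def qsum_def mult_ac mult_1 mult_1_right)
  qed
qed

end
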